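(* Let $G=(V,E,L,\ell)$ be an edge-labeled hypergraph and let $d_{\mathit{max}}$ be the largest number of hyperedges that any node participates in. For every $\beta>d_{\mathit{max}}$, a minority vote assignment optimizes the diversity-regularized categorical edge clustering (DRCEC) objective with parameter $\beta$; that is, there is a minority vote clustering whose DRCEC objective value is minimum among all clusterings.
   Context: $G=(V,E,L,\ell)$ is a finite hypergraph with labeled hyperedges: $V$ is the node set, $E$ the set of hyperedges, $L=\{1,\dots,k\}$ the set of labels ("colors"), and $\ell\colon E\to L$ assigns a color to each hyperedge. $E_c\subseteq E$ is the set of hyperedges of color $c$. For $v\in V$, $c\in L$, the color degree $d_v^c$ is the number of hyperedges of color $c$ that contain $v$; $d_{\mathit{max}}=\max_{v\in V}\sum_{c\in L}d_v^c$. A clustering assigns each node to exactly one color in $L$. A minority vote clustering (assignment) is one in which each node $v$ is assigned a color $i\in\operatorname{argmin}_{c\in L}d_v^c$ (when this set has more than one element, $v$ may be assigned any of its elements, so minority vote clusterings need not be unique). The DRCEC objective with parameter $\beta\ge 0$ is the integer linear program $$\min\ \sum_{c\in L}\sum_{e\in E_c}x_e+\beta\sum_{v\in V}\sum_{c\in L}d_v^c(1-x_v^c)$$ subject to: $\sum_{c=1}^k x_v^c=k-1$ for all $v\in V$; $x_v^c\le x_e$ for all $c\in L$, $e\in E_c$, $v\in e$; and $x_v^c,x_e\in\{0,1\}$ for all $c\in L$, $v\in V$, $e\in E$. Here $x_v^c=0$ means that $v$ is assigned color $c$ (and $x_v^c=1$ that it is not). A clustering determines the variables $x_v^c$, and its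 objective value is the one obtained by setting, for $e\in E_c$, $x_e=1$ if some node of $e$ is not assigned color $c$ and $x_e=0$ otherwise. *)

theory Defs
  imports Complex_Main
begin

text \<open>
  A hypergraph has node set \<open>V\<close>, hyperedges \<open>E\<close> (a set of subsets of \<open>V\<close>), colors \<open>{1..k}\<close> and
  coloring \<open>l\<close>. There is at least one color, since otherwise nodes cannot be assigned a color.
\<close>

definition edge_labeled_hypergraph ::
  "'v set \<Rightarrow> 'v set set \<Rightarrow> nat \<Rightarrow> ('v set \<Rightarrow> nat) \<Rightarrow> bool" where
  "edge_labeled_hypergraph V E k l \<longleftrightarrow>
     finite V \<and> E \<subseteq> Pow V \<and> 1 \<le> k \<and> (\<forall>e\<in>E. l e \<in> {1..k})"

definition edges_of_color :: "'v set set \<Rightarrow> ('v set \<Rightarrow> nat) \<Rightarrow> nat \<Rightarrow> 'v set set" where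
  "edges_of_color E l c = {e \<in> E. l e = c}"

definition color_degree :: "'v set set \<Rightarrow> ('v set \<Rightarrow> nat) \<Rightarrow> 'v \<Rightarrow> nat \<Rightarrow> nat" where
  "color_degree E l v c = card {e \<in> edges_of_color E l c. v \<in> e}"

definition d_max :: "'v set \<Rightarrow> 'v set set \<Rightarrow> nat \<Rightarrow> ('v set \<Rightarrow> nat) \<Rightarrow> nat" where
  "d_max V E k l = Max ((\<lambda>v. \<Sum>c\<in>{1..k}. color_degree E l v c) ` V)"

text \<open>Only the values of a clustering on \<open>V\<close> are relevant.\<close>

definition clustering :: "'v set \<Rightarrow> nat \<Rightarrow> ('v \<Rightarrow> nat) \<Rightarrow> bool" where
  "clustering V k f \<longleftrightarrow> (\<forall>v\<in>V. f v \<in> {1..k})"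

definition minority_vote_clustering ::
  "'v set \<Rightarrow> 'v set set \<Rightarrow> nat \<Rightarrow> ('v set \<Rightarrow> nat) \<Rightarrow> ('v \<Rightarrow> nat) \<Rightarrow> bool" where
  "minority_vote_clustering V E k l f \<longleftrightarrow>
     (\<forall>v\<in>V. is_arg_min (color_degree E l v) (\<lambda>c. c \<in> {1..k}) (f v))"

text \<open>
  The integer linear program, in variables \<open>xv v c\<close> (which is \<open>0\<close> iff \<open>v\<close> is assigned color \<open>c\<close>)
  and \<open>xe e\<close>.
\<close>

definition drcec_objective ::
  "'v set \<Rightarrow> 'v set set \<Rightarrow> nat \<Rightarrow> ('v set \<Rightarrow> nat) \<Rightarrow> real \<Rightarrow>
    ('v \<Rightarrow> nat \<Rightarrow> real) \<Rightarrow> ('v set \<Rightarrow> real) \<Rightarrow> real" where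
  "drcec_objective V E k l \<beta> xv xe =
     (\<Sum>c\<in>{1..k}. \<Sum>e\<in>edges_of_color E l c. xe e)
     + \<beta> * (\<Sum>v\<in>V. \<Sum>c\<in>{1..k}. real (color_degree E l v c) * (1 - xv v c))"

definition drcec_feasible ::
  "'v set \<Rightarrow> 'v set set \<Rightarrow> nat \<Rightarrow> ('v set \<Rightarrow> nat) \<Rightarrow>
    ('v \<Rightarrow> nat \<Rightarrow> real) \<Rightarrow> ('v set \<Rightarrow> real) \<Rightarrow> bool" where
  "drcec_feasible V E k l xv xe \<longleftrightarrow>
     (\<forall>v\<in>V. (\<Sum>c\<in>{1..k}. xv v c) = real k - 1) \<and>
     (\<forall>c\<in>{1..k}. \<forall>e\<in>edges_of_color E l c. \<forall>v\<in>e. xv v c \<le> xe e) \<and>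
     (\<forall>v\<in>V. \<forall>c\<in>{1..k}. xv v c \<in> {0, 1}) \<and>
     (\<forall>e\<in>E. xe e \<in> {0, 1})"

definition node_var :: "('v \<Rightarrow> nat) \<Rightarrow> 'v \<Rightarrow> nat \<Rightarrow> real" where
  "node_var f v c = (if f v = c then 0 else 1)"

definition edge_var :: "('v set \<Rightarrow> nat) \<Rightarrow> ('v \<Rightarrow> nat) \<Rightarrow> 'v set \<Rightarrow> real" where
  "edge_var l f e = (if \<exists>v\<in>e. f v \<noteq> l e then 1 else 0)"

definition drcec_value ::
  "'v set \<Rightarrow> 'v set set \<Rightarrow> nat \<Rightarrow> ('v set \<Rightarrow> nat) \<Rightarrow> real \<Rightarrow> ('v \<Rightarrow> nat) \<Rightarrow> real" where
  "drcec_value V E k l \<beta> f = drcec_objective V E k l \<beta> (node_var f) (edge_var l f)"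

text \<open>
  The next two lemmas show that minimizing \<open>drcec_value\<close> over clusterings is the same as solving
  the integer linear program.
\<close>

lemma clustering_feasible:
  assumes "clustering V k f"
  shows "drcec_feasible V E k l (node_var f) (edge_var l f)"
proof -
  have "(\<Sum>c\<in>{1..k}. node_var f v c) = real k - 1" if "v \<in> V" for v
  proof -
    have fv: "f v \<in> {1..k}"
      using assms that by (auto simp: clustering_def)
    have "(\<Sum>c\<in>{1..k}. node_var f v c) = (\<Sum>c\<in>{1..k}. 1 - (if f v = c then 1 else 0))"
      by (rule sum.cong) (auto simp: node_var_def)
    also have "\<dots> = real k - 1"
      using fv by (simp add: sum_subtractf)
    finally show ?thesis .
  qed
  then show ?thesis
    by (auto simp: drcec_feasible_def node_var_def edge_var_def edges_of_color_def)
qed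

lemma feasible_clustering:
  assumes G: "edge_labeled_hypergraph V E k l" and feas: "drcec_feasible V E k l xv xe"
  obtains f where "clustering V k f"
    and "\<And>v c. v \<in> V \<Longrightarrow> c \<in> {1..k} \<Longrightarrow> xv v c = node_var f v c"
    and "drcec_value V E k l \<beta> f \<le> drcec_objective V E k l \<beta> xv xe"
proof -
  have "\<exists>i\<in>{1..k}. \<forall>c\<in>{1..k}. xv v c = (if i = c then 0 else 1)" if v: "v \<in> V" for v
  proof -
    have bin: "xv v c = 0 \<or> xv v c = 1" if "c \<in> {1..k}" for c
      using feas v that by (auto simp: drcec_feasible_def)
    have total: "(\<Sum>c\<in>{1..k}. xv v c) = real k - 1"
      using feas v by (auto simp: drcec_feasible_def)
    have "real (card {c\<in>{1..k}. xv v c = 0}) = (\<Sum>c\<in>{1..k}. if xv v c = 0 then 1 else 0)"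
      by (simp add: sum.If_cases Int_def)
    also have "\<dots> = (\<Sum>c\<in>{1..k}. 1 - xv v c)"
      by (rule sum.cong) (use bin in auto)
    also have "\<dots> = 1"
      using total by (simp add: sum_subtractf)
    finally have "card {c\<in>{1..k}. xv v c = 0} = 1"
      by simp
    then obtain i where i: "{c\<in>{1..k}. xv v c = 0} = {i}"
      by (rule card_1_singletonE)
    then have "i \<in> {1..k}" by blast
    moreover have "xv v c = (if i = c then 0 else 1)" if "c \<in> {1..k}" for c
      using i bin[OF that] that by auto
    ultimately show ?thesis by blast
  qed
  then obtain f where f: "\<And>v. v \<in> V \<Longrightarrow> f v \<in> {1..k}"
    and xv: "\<And>v c. v \<in> V \<Longrightarrow> c \<in> {1..k} \<Longrightarrow> xv v c = node_var f v c"
    unfolding node_var_def by metis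
  have le: "edge_var l f e \<le> xe e" if "c \<in> {1..k}" "e \<in> edges_of_color E l c" for c e
  proof (cases "\<exists>v\<in>e. f v \<noteq> l e")
    case True
    then obtain v where v: "v \<in> e" "f v \<noteq> l e" by blast
    have "e \<in> E" "l e = c" using that by (auto simp: edges_of_color_def)
    then have "v \<in> V" using v G by (auto simp: edge_labeled_hypergraph_def)
    then have "xv v c = 1"
      using v xv[of v c] that \<open>l e = c\<close> by (auto simp: node_var_def)
    moreover have "xv v c \<le> xe e"
      using feas that v unfolding drcec_feasible_def by blast
    ultimately show ?thesis by (simp add: edge_var_def)
  next
    case False
    have "xe e = 0 \<or> xe e = 1"
      using feas that by (auto simp: drcec_feasible_def edges_of_color_def)
    with False show ?thesis by (auto simp: edge_var_def)
  qed
  have "(\<Sum>v\<in>V. \<Sum>c\<in>{1..k}. real (color_degree E l v c) * (1 - node_var f v c))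
      = (\<Sum>v\<in>V. \<Sum>c\<in>{1..k}. real (color_degree E l v c) * (1 - xv v c))"
    by (intro sum.cong refl) (simp add: xv)
  moreover have "(\<Sum>c\<in>{1..k}. \<Sum>e\<in>edges_of_color E l c. edge_var l f e)
      \<le> (\<Sum>c\<in>{1..k}. \<Sum>e\<in>edges_of_color E l c. xe e)"
    by (intro sum_mono le)
  ultimately have "drcec_value V E k l \<beta> f \<le> drcec_objective V E k l \<beta> xv xe"
    by (simp add: drcec_value_def drcec_objective_def)
  then show ?thesis
    using that f xv by (auto simp: clustering_def)
qed

end

theory Submission
  imports Defs
begin

text \<open>
  Recoloring a node by a color of smaller degree creates at most \<open>d_max\<close> new mistakes and saves at
  least \<open>\<beta> > d_max\<close> in the regularizer, because degrees are integers. Hence every clustering is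
  dominated by a minority vote clustering. All minority vote clusterings have the same regularization
  cost, so one with the fewest mistakes is optimal.
\<close>

text \<open>The hyperedges with \<open>edge_var l f e = 1\<close>. Keeping them as a set lets two
  clusterings be compared by inclusion.\<close>

definition mistakes :: "'v set set \<Rightarrow> ('v set \<Rightarrow> nat) \<Rightarrow> ('v \<Rightarrow> nat) \<Rightarrow> 'v set set" where
  "mistakes E l f = {e \<in> E. \<exists>v\<in>e. f v \<noteq> l e}"

lemma edge_labeled_hypergraph_finite:
  assumes "edge_labeled_hypergraph V E k l"
  shows "finite V" "finite E"
  using assms by (auto simp: edge_labeled_hypergraph_def intro: finite_subset[of E "Pow V"])

text \<open>Every label lies in \<open>{1..k}\<close>, so the color classes partition
  \<open>E\<close>. The summand \<open>h\<close> is arbitrary because this is applied both to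
  \<open>edge_var\<close> and to the indicator of incidence with a fixed node.\<close>

lemma sum_edges_of_color:
  assumes "edge_labeled_hypergraph V E k l"
  shows "(\<Sum>c\<in>{1..k}. \<Sum>e\<in>edges_of_color E l c. h e) = (\<Sum>e\<in>E. h e)"
  unfolding edges_of_color_def
  using assms edge_labeled_hypergraph_finite[OF assms]
  by (intro sum.group) (auto simp: edge_labeled_hypergraph_def)

text \<open>The factor \<open>1 - node_var f v c\<close> vanishes except at \<open>c = f v\<close>,
  which is one of the colors summed over, so each node contributes a single degree.\<close>

lemma drcec_value_eq:
  assumes G: "edge_labeled_hypergraph V E k l" and f: "clustering V k f"
  shows "drcec_value V E k l \<beta> f =
    real (card (mistakes E l f)) + \<beta> * (\<Sum>v\<in>V. real (color_degree E l v (f v)))"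
proof -
  have "(\<Sum>c\<in>{1..k}. \<Sum>e\<in>edges_of_color E l c. edge_var l f e) = (\<Sum>e\<in>E. edge_var l f e)"
    using G by (rule sum_edges_of_color)
  also have "\<dots> = real (card (mistakes E l f))"
    using edge_labeled_hypergraph_finite(2)[OF G]
    by (simp add: edge_var_def mistakes_def sum.If_cases Int_def)
  finally have errors: "(\<Sum>c\<in>{1..k}. \<Sum>e\<in>edges_of_color E l c. edge_var l f e) =
    real (card (mistakes E l f))" .
  have "(\<Sum>c\<in>{1..k}. real (color_degree E l v c) * (1 - node_var f v c)) =
      real (color_degree E l v (f v))" if "v \<in> V" for v
  proof -
    have "(\<Sum>c\<in>{1..k}. real (color_degree E l v c) * (1 - node_var f v c)) =
        (\<Sum>c\<in>{1..k}. if f v = c then real (color_degree E l v c) else 0)"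
      by (rule sum.cong) (auto simp: node_var_def)
    also have "\<dots> = real (color_degree E l v (f v))"
      using f that by (auto simp: clustering_def)
    finally show ?thesis .
  qed
  with errors show ?thesis
    by (simp add: drcec_value_def drcec_objective_def)
qed

text \<open>Since each hyperedge has exactly one color, the color degrees of \<open>v\<close> add up
  to the number of hyperedges through \<open>v\<close>.\<close>

lemma card_incident_edges_le_d_max:
  assumes G: "edge_labeled_hypergraph V E k l" and v: "v \<in> V"
  shows "card {e \<in> E. v \<in> e} \<le> d_max V E k l"
proof -
  have "finite E"
    using G by (rule edge_labeled_hypergraph_finite)
  then have fin: "finite (edges_of_color E l c)" for c
    by (simp add: edges_of_color_def)
  have "card {e \<in> E. v \<in> e} = (\<Sum>e\<in>E. if v \<in> e then 1 else 0)"
    using \<open>finite E\<close> by (simp add: sum.If_cases Int_def)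
  also have "\<dots> = (\<Sum>c\<in>{1..k}. \<Sum>e\<in>edges_of_color E l c. if v \<in> e then 1 else 0)"
    using sum_edges_of_color[OF G] by metis
  also have "\<dots> = (\<Sum>c\<in>{1..k}. color_degree E l v c)"
    using fin by (simp add: color_degree_def sum.If_cases Int_def)
  also have "\<dots> \<le> d_max V E k l"
    unfolding d_max_def using v edge_labeled_hypergraph_finite(1)[OF G] by (intro Max_ge) auto
  finally show ?thesis .
qed

text \<open>A mistake of \<open>f\<close> that is not one of \<open>g\<close> must contain a node on
  which the two disagree. A union bound over these nodes then suffices.\<close>

lemma card_mistakes_le:
  assumes G: "edge_labeled_hypergraph V E k l"
  shows "card (mistakes E l f) \<le>
    card (mistakes E l g) + card {v \<in> V. f v \<noteq> g v} * d_max V E k l"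
proof -
  let ?S = "{v \<in> V. f v \<noteq> g v}"
  note fin = edge_labeled_hypergraph_finite[OF G]
  have "mistakes E l f \<subseteq> mistakes E l g \<union> (\<Union>v\<in>?S. {e \<in> E. v \<in> e})"
  proof
    fix e assume "e \<in> mistakes E l f"
    then obtain v where v: "e \<in> E" "v \<in> e" "f v \<noteq> l e"
      by (auto simp: mistakes_def)
    then have "v \<in> V"
      using G by (auto simp: edge_labeled_hypergraph_def)
    with v show "e \<in> mistakes E l g \<union> (\<Union>v\<in>?S. {e \<in> E. v \<in> e})"
      by (cases "f v = g v") (auto simp: mistakes_def)
  qed
  then have "card (mistakes E l f) \<le> card (mistakes E l g \<union> (\<Union>v\<in>?S. {e \<in> E. v \<in> e}))"
    using fin by (intro card_mono) (auto simp: mistakes_def)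
  also have "\<dots> \<le> card (mistakes E l g) + card (\<Union>v\<in>?S. {e \<in> E. v \<in> e})"
    by (rule card_Un_le)
  also have "card (\<Union>v\<in>?S. {e \<in> E. v \<in> e}) \<le> (\<Sum>v\<in>?S. card {e \<in> E. v \<in> e})"
    using fin by (intro card_UN_le) simp
  also have "\<dots> \<le> card ?S * d_max V E k l"
    using sum_bounded_above[of ?S "\<lambda>v. card {e \<in> E. v \<in> e}" "d_max V E k l"]
      card_incident_edges_le_d_max[OF G] by simp
  finally show ?thesis by simp
qed

lemma minority_vote_clustering_dominates:
  assumes G: "edge_labeled_hypergraph V E k l" and \<beta>: "real (d_max V E k l) \<le> \<beta>"
    and g: "clustering V k g"
  obtains f where "minority_vote_clustering V E k l f" "clustering V k f"
    "drcec_value V E k l \<beta> f \<le> drcec_value V E k l \<beta> g"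
proof -
  let ?min = "\<lambda>v. is_arg_min (color_degree E l v) (\<lambda>c. c \<in> {1..k})"
  let ?d = "\<lambda>f v. real (color_degree E l v (f v))"
  \<comment> \<open>Keeping \<open>g v\<close> whenever it is already minimal ensures that
    \<open>f\<close> and \<open>g\<close> differ only where the degree strictly drops; switching
    between tied colors could cost mistakes and save nothing.\<close>
  define f where "f v = (if ?min v (g v) then g v else (SOME c. ?min v c))" for v
  have "\<exists>c. ?min v c" for v
  proof -
    have "1 \<in> {1..k}"
      using G by (simp add: edge_labeled_hypergraph_def)
    from ex_has_least_nat[where P = "\<lambda>c. c \<in> {1..k}" and m = "color_degree E l v", OF this]
    show ?thesis
      unfolding is_arg_min_linorder by blast
  qed
  then have f_min: "?min v (f v)" for v
    unfolding f_def by (auto intro: someI_ex)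
  then have f_minority: "minority_vote_clustering V E k l f"
    by (simp add: minority_vote_clustering_def)
  have f: "clustering V k f"
    using f_min by (simp add: clustering_def is_arg_min_def)
  let ?S = "{v \<in> V. f v \<noteq> g v}"
  \<comment> \<open>The strict drop of a natural number is at least 1, so summing over
    \<open>V\<close> yields a saving of \<open>card ?S\<close>.\<close>
  have "?d f v + (if f v \<noteq> g v then 1 else 0) \<le> ?d g v" if "v \<in> V" for v
  proof (cases "f v = g v")
    case False
    then have not_min: "\<not> ?min v (g v)"
      by (auto simp: f_def)
    have "g v \<in> {1..k}"
      using g that by (simp add: clustering_def)
    with not_min obtain c where "c \<in> {1..k}" "color_degree E l v c < color_degree E l v (g v)"
      by (auto simp: is_arg_min_def)
    then have "color_degree E l v (f v) < color_degree E l v (g v)"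
      using f_min[of v] unfolding is_arg_min_linorder by fastforce
    with False show ?thesis by simp
  qed simp
  then have "(\<Sum>v\<in>V. ?d f v + (if f v \<noteq> g v then 1 else 0)) \<le> (\<Sum>v\<in>V. ?d g v)"
    by (rule sum_mono)
  then have "(\<Sum>v\<in>V. ?d f v) + real (card ?S) \<le> (\<Sum>v\<in>V. ?d g v)"
    using edge_labeled_hypergraph_finite(1)[OF G] by (simp add: sum.distrib sum.If_cases Int_def)
  \<comment> \<open>\<open>d_max\<close> is a natural number, even for empty \<open>V\<close>, where
    it is the \<open>Max\<close> of an empty set.\<close>
  moreover have "0 \<le> \<beta>"
    using \<beta> by linarith
  ultimately have "\<beta> * ((\<Sum>v\<in>V. ?d f v) + real (card ?S)) \<le> \<beta> * (\<Sum>v\<in>V. ?d g v)"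
    by (intro mult_left_mono)
  moreover have "real (card (mistakes E l f)) \<le>
      real (card (mistakes E l g)) + real (card ?S) * real (d_max V E k l)"
    using card_mistakes_le[OF G, of f g] by (metis of_nat_add of_nat_le_iff of_nat_mult)
  moreover have "real (card ?S) * real (d_max V E k l) \<le> real (card ?S) * \<beta>"
    using \<beta> by (intro mult_left_mono) auto
  ultimately have "drcec_value V E k l \<beta> f \<le> drcec_value V E k l \<beta> g"
    unfolding drcec_value_eq[OF G f] drcec_value_eq[OF G g] by (simp add: algebra_simps)
  with f_minority f show ?thesis
    by (rule that)
qed

theorem theorem4:
  fixes V :: "'v set" and E :: "'v set set" and k :: nat and l :: "'v set \<Rightarrow> nat" and \<beta> :: real
  assumes "edge_labeled_hypergraph V E k l"
    and "\<beta> > real (d_max V E k l)"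
  shows "\<exists>f. minority_vote_clustering V E k l f \<and>
    is_arg_min (drcec_value V E k l \<beta>) (clustering V k) f"
proof -
  let ?M = "minority_vote_clustering V E k l"
  note G = assms(1)
  have \<beta>: "real (d_max V E k l) \<le> \<beta>"
    using assms(2) by simp
  have M_clustering: "clustering V k h" if "?M h" for h
    using that by (auto simp: minority_vote_clustering_def clustering_def is_arg_min_def)
  \<comment> \<open>Any clustering serves here: the minority vote clustering dominating it shows
    that one exists.\<close>
  have "clustering V k (\<lambda>_. 1)"
    using G by (simp add: clustering_def edge_labeled_hypergraph_def)
  then obtain h where "?M h"
    using minority_vote_clustering_dominates[OF G \<beta>] by metis
  \<comment> \<open>Well-ordering of the mistake counts gives a minimum although there may be
    infinitely many such functions, their values outside \<open>V\<close> being arbitrary.\<close>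
  from ex_has_least_nat[where P = ?M and m = "\<lambda>f. card (mistakes E l f)", OF this]
  obtain f where f: "?M f"
    and f_least: "\<And>h. ?M h \<Longrightarrow> card (mistakes E l f) \<le> card (mistakes E l h)"
    by blast
  have "drcec_value V E k l \<beta> f \<le> drcec_value V E k l \<beta> g" if g: "clustering V k g" for g
  proof -
    obtain h where h: "?M h" "drcec_value V E k l \<beta> h \<le> drcec_value V E k l \<beta> g"
      using minority_vote_clustering_dominates[OF G \<beta> g] by metis
    \<comment> \<open>Both colors minimize the same degree function, so the regularization terms
      agree and only the mistakes are left to compare.\<close>
    have "color_degree E l v (f v) = color_degree E l v (h v)" if "v \<in> V" for v
      using f h(1) that unfolding minority_vote_clustering_def is_arg_min_linorder
      by (meson order_antisym)
    then have "drcec_value V E k l \<beta> f \<le> drcec_value V E k l \<beta> h"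
      using f_least[OF h(1)]
      by (simp add: drcec_value_eq[OF G M_clustering[OF f]] drcec_value_eq[OF G M_clustering[OF h(1)]])
    with h(2) show ?thesis
      by simp
  qed
  with f M_clustering[OF f] show ?thesis
    unfolding is_arg_min_linorder by blast
qed

end
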